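(* Let $\lambda$ be a nonzero complex number, let $U_n$ and $T_n$ be the Chebyshev polynomials of the second and first kind, and put $\widehat{U_n}(\lambda)=\int_{-1}^{1}U_n(x)e^{i\lambda x}\,dx$ and $\widehat{T_n}(\lambda)=\int_{-1}^{1}T_n(x)e^{i\lambda x}\,dx$. Then for every integer $n\ge 0$, $$\widehat{U_n}(\lambda)=e^{i\lambda}\sum_{k=0}^{n}2^{2k+1}k!\binom{n+k+1}{n-k}\left[\frac{e^{-2i\lambda}E_k(2i\lambda)-1}{(-2i\lambda)^{k+1}}\right]=\sum_{k=0}^{n}\frac{2^{2k+1}(n+k+1)!\,k!}{(2k+1)!\,(n-k)!}\,\frac{(-1)^{n-k}e^{-i\lambda}-e^{i\lambda}}{(-2i\lambda)^{k+1}},$$ and for every integer $n\ge 1$, $$\widehat{T_n}(\lambda)=\sum_{k=0}^{n}(-1)^{k+1}\frac{n\,2^{k}(n+k)!\,k!}{(n-k)!\,(2k)!\,(n+k)}\,\frac{(-1)^{n-k}e^{-i\lambda}-e^{i\lambda}}{(i\lambda)^{k+1}}.$$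
   Context: $T_n$ and $U_n$ are the standard Chebyshev polynomials, $T_n(\cos\theta)=\cos n\theta$ and $U_n(\cos\theta)=\sin((n+1)\theta)/\sin\theta$; in terms of Gegenbauer polynomials, $U_n=C_n^{(1)}$ and $T_n=\lim_{\nu\to0}\frac{n\,C_n^{(\nu)}}{2\nu}$ for $n\ge1$. $E_k(x)=\sum_{j=0}^{k}\frac{x^j}{j!}$. *)

theory Defs
  imports "HOL-Analysis.Analysis" "HOL-Computational_Algebra.Polynomial"
begin

definition cheb_T :: "nat \<Rightarrow> real poly" where
  "cheb_T n = (THE p. \<forall>\<theta>. poly p (cos \<theta>) = cos (real n * \<theta>))"

definition cheb_U :: "nat \<Rightarrow> real poly" where
  "cheb_U n = (THE p. \<forall>\<theta>. sin \<theta> \<noteq> 0 \<longrightarrow> poly p (cos \<theta>) = sin (real (n + 1) * \<theta>) / sin \<theta>)"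

definition hat :: "real poly \<Rightarrow> complex \<Rightarrow> complex" where
  "hat p lam = integral {-1..1} (\<lambda>x. complex_of_real (poly p x) * exp (\<i> * lam * complex_of_real x))"

definition exp_trunc :: "nat \<Rightarrow> complex \<Rightarrow> complex" where
  "exp_trunc k x = (\<Sum>j=0..k. x ^ j / fact j)"

text \<open>Both definite descriptions are proper, and the integrand of \<^const>\<open>hat\<close> is integrable.\<close>

lemma cheb_exists:
  "\<exists>p q :: real poly. \<forall>\<theta>. poly p (cos \<theta>) = cos (real n * \<theta>) \<and>
     poly q (cos \<theta>) * sin \<theta> = sin (real n * \<theta>)"
proof (induction n)
  case 0
  show ?case by (intro exI[of _ 1] exI[of _ 0]) simp
next
  case (Suc n)
  then obtain p q :: "real poly" where
    p: "\<And>\<theta>. poly p (cos \<theta>) = cos (real n * \<theta>)" and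
    q: "\<And>\<theta>. poly q (cos \<theta>) * sin \<theta> = sin (real n * \<theta>)" by blast
  have "poly ([:0, 1:] * p - [:1, 0, -1:] * q) (cos \<theta>) = cos (real (Suc n) * \<theta>)" for \<theta>
  proof -
    have "poly ([:0, 1:] * p - [:1, 0, -1:] * q) (cos \<theta>)
        = cos \<theta> * poly p (cos \<theta>) - (1 - (cos \<theta>)\<^sup>2) * poly q (cos \<theta>)"
      by (simp add: power2_eq_square algebra_simps)
    also have "1 - (cos \<theta>)\<^sup>2 = (sin \<theta>)\<^sup>2"
      by (simp add: sin_squared_eq)
    finally have "poly ([:0, 1:] * p - [:1, 0, -1:] * q) (cos \<theta>)
        = cos \<theta> * poly p (cos \<theta>) - sin \<theta> * (poly q (cos \<theta>) * sin \<theta>)"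
      by (simp add: power2_eq_square mult_ac)
    then show ?thesis
      by (simp add: p q distrib_right cos_add)
  qed
  moreover have "poly ([:0, 1:] * q + p) (cos \<theta>) * sin \<theta> = sin (real (Suc n) * \<theta>)" for \<theta>
  proof -
    have "poly ([:0, 1:] * q + p) (cos \<theta>) * sin \<theta>
        = cos \<theta> * (poly q (cos \<theta>) * sin \<theta>) + poly p (cos \<theta>) * sin \<theta>"
      by (simp add: algebra_simps)
    then show ?thesis
      by (simp add: p q distrib_right sin_add)
  qed
  ultimately show ?case by blast
qed

lemma poly_eqI_cos:
  fixes p q :: "real poly"
  assumes "\<And>\<theta>. sin \<theta> \<noteq> 0 \<Longrightarrow> poly p (cos \<theta>) = poly q (cos \<theta>)"
  shows "p = q"
proof (rule ccontr)
  assume "p \<noteq> q"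
  then have fin: "finite {x. poly (p - q) x = 0}"
    by (intro poly_roots_finite) simp
  have "{-1<..<1} \<subseteq> {x. poly (p - q) x = 0}"
  proof
    fix x :: real assume x: "x \<in> {-1<..<1}"
    then have "sin (arccos x) > 0"
      by (intro sin_gt_zero arccos_lt_bounded[THEN conjunct1] arccos_lt_bounded[THEN conjunct2]) auto
    with assms[of "arccos x"] x show "x \<in> {x. poly (p - q) x = 0}" by simp
  qed
  with fin have "finite {-1<..<1::real}" by (rule finite_subset[rotated])
  then show False using infinite_Ioo[of "-1 :: real" 1] by simp
qed

lemma cheb_T_cos: "poly (cheb_T n) (cos \<theta>) = cos (real n * \<theta>)"
proof -
  have "\<exists>!p :: real poly. \<forall>\<theta>. poly p (cos \<theta>) = cos (real n * \<theta>)"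
    using cheb_exists[of n] by (auto intro: poly_eqI_cos)
  from theI'[OF this] show ?thesis unfolding cheb_T_def by blast
qed

lemma cheb_U_cos:
  assumes "sin \<theta> \<noteq> 0"
  shows "poly (cheb_U n) (cos \<theta>) = sin (real (n + 1) * \<theta>) / sin \<theta>"
proof -
  obtain q :: "real poly" where q: "\<And>\<theta>. poly q (cos \<theta>) * sin \<theta> = sin (real (n + 1) * \<theta>)"
    using cheb_exists[of "n + 1"] by blast
  have "\<exists>!p :: real poly. \<forall>\<theta>. sin \<theta> \<noteq> 0 \<longrightarrow> poly p (cos \<theta>) = sin (real (n + 1) * \<theta>) / sin \<theta>"
  proof (rule ex1I[of _ q])
    show "\<forall>\<theta>. sin \<theta> \<noteq> 0 \<longrightarrow> poly q (cos \<theta>) = sin (real (n + 1) * \<theta>) / sin \<theta>"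
      using q by (metis nonzero_mult_div_cancel_right)
    then show "p = q" if "\<forall>\<theta>. sin \<theta> \<noteq> 0 \<longrightarrow> poly p (cos \<theta>) = sin (real (n + 1) * \<theta>) / sin \<theta>" for p
      using that by (intro poly_eqI_cos) simp
  qed
  from theI'[OF this] assms show ?thesis unfolding cheb_U_def by blast
qed

lemma hat_integrable:
  "(\<lambda>x. complex_of_real (poly p x) * exp (\<i> * lam * complex_of_real x)) integrable_on {-1..1}"
  by (intro integrable_continuous_real continuous_intros)

end

theory Submission
  imports Defs
begin

text \<open>Integrating by parts, \<open>i\<lambda> \<cdot> hat p \<lambda>\<close> is a boundary term minus \<open>hat p' \<lambda>\<close>. Iterating this
  expresses the transform through the derivatives of \<open>p\<close> at \<open>\<plusminus>1\<close>, and applying it to \<open>(x - 1)\<^sup>k\<close>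
  produces the truncated exponentials. The derivatives at \<open>1\<close> are read off from the expansion
  \<open>U\<^sub>n(x) = \<Sum>\<^sub>k binom(n+k+1, 2k+1) (2(x-1))\<^sup>k\<close>, which follows from the three-term recurrence and
  Pascal's rule; those at \<open>-1\<close> follow by parity, and the case of \<open>T\<^sub>n\<close> from \<open>T\<^sub>n' = n U\<^sub>n\<^sub>-\<^sub>1\<close>.\<close>

section \<open>Integration by parts and transforms of polynomials\<close>

lemma hat_by_parts:
  assumes "lam \<noteq> 0"
  shows "hat p lam = (of_real (poly p 1) * exp (\<i> * lam) - of_real (poly p (-1)) * exp (- (\<i> * lam))
           - hat (pderiv p) lam) / (\<i> * lam)"
proof -
  let ?e = "\<lambda>x. exp (\<i> * lam * complex_of_real x)"
  let ?f = "\<lambda>x. of_real (poly p x) * ?e x"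
  have "((\<lambda>x. of_real (poly (pderiv p) x) * ?e x + \<i> * lam * (of_real (poly p x) * ?e x))
          has_integral (?f 1 - ?f (-1))) {-1..1}"
  proof (rule fundamental_theorem_of_calculus)
    fix x :: real
    have "((\<lambda>z. exp (\<i> * lam * z)) has_field_derivative \<i> * lam * ?e x) (at (of_real x))"
      by (auto intro!: derivative_eq_intros)
    then have "(?e has_vector_derivative \<i> * lam * ?e x) (at x within {-1..1})"
      by (rule has_vector_derivative_real_field)
    moreover have "((\<lambda>x. of_real (poly p x)) has_vector_derivative complex_of_real (poly (pderiv p) x))
        (at x within {-1..1})"
      by (rule has_vector_derivative_of_real[OF has_field_derivative_at_within[OF poly_DERIV]])
    ultimately have "(?f has_vector_derivative
        of_real (poly p x) * (\<i> * lam * ?e x) + of_real (poly (pderiv p) x) * ?e x) (at x within {-1..1})"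
      by (rule has_vector_derivative_mult[rotated])
    then show "(?f has_vector_derivative
        of_real (poly (pderiv p) x) * ?e x + \<i> * lam * (of_real (poly p x) * ?e x)) (at x within {-1..1})"
      by (simp only: add.commute mult.left_commute)
  qed simp
  then have "integral {-1..1} (\<lambda>x. of_real (poly (pderiv p) x) * ?e x
      + \<i> * lam * (of_real (poly p x) * ?e x)) = ?f 1 - ?f (-1)"
    by (rule integral_unique)
  moreover have "(\<lambda>x. \<i> * lam * (of_real (poly p x) * ?e x)) integrable_on {-1..1}"
    by (rule integrable_on_mult_right[OF hat_integrable])
  ultimately have "hat (pderiv p) lam + \<i> * lam * hat p lam = ?f 1 - ?f (-1)"
    unfolding hat_def integral_mult_right[symmetric]
    by (simp only: Henstock_Kurzweil_Integration.integral_add[OF hat_integrable])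
  then have "\<i> * lam * hat p lam = ?f 1 - ?f (-1) - hat (pderiv p) lam"
    by (simp only: eq_diff_eq add.commute)
  with assms show ?thesis
    by (simp add: eq_divide_eq mult.commute[of "hat p lam"])
qed

lemma hat_0: "hat 0 lam = 0"
  by (simp add: hat_def)

lemma hat_add: "hat (p + q) lam = hat p lam + hat q lam"
proof -
  have "hat (p + q) lam = integral {-1..1} (\<lambda>x. complex_of_real (poly p x) * exp (\<i> * lam * complex_of_real x)
      + complex_of_real (poly q x) * exp (\<i> * lam * complex_of_real x))"
    by (simp add: hat_def distrib_right)
  then show ?thesis
    by (simp add: hat_def Henstock_Kurzweil_Integration.integral_add hat_integrable)
qed

lemma hat_smult: "hat (smult c p) lam = of_real c * hat p lam"
  by (simp add: hat_def mult.assoc)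

lemma hat_sum: "hat (sum f A) lam = (\<Sum>k\<in>A. hat (f k) lam)"
  by (induction A rule: infinite_finite_induct) (simp_all add: hat_0 hat_add)

text \<open>Repeated integration by parts stops because the derivative of order \<open>n + 1\<close>
  vanishes, so only boundary terms remain. A bound on the degree, rather than its exact value,
  passes directly from \<open>p\<close> to \<open>pderiv p\<close> in the induction. Each boundary
  term is taken as the value at -1 minus the value at 1, which accounts for the sign
  \<open>(-1) ^ (k + 1)\<close>.\<close>

lemma hat_eq_sum_higher_pderiv:
  assumes "lam \<noteq> 0" and "degree p \<le> n"
  shows "hat p lam = (\<Sum>k=0..n. (-1) ^ (k + 1) *
    ((of_real (poly ((pderiv ^^ k) p) (-1)) * exp (- (\<i> * lam))
      - of_real (poly ((pderiv ^^ k) p) 1) * exp (\<i> * lam)) / (\<i> * lam) ^ (k + 1)))"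
  using assms(2)
proof (induction n arbitrary: p)
  case 0
  then have "pderiv p = 0" by (simp add: pderiv_eq_0_iff)
  with hat_by_parts[OF assms(1), of p] show ?case
    by (simp add: hat_0 field_simps)
next
  case (Suc n)
  have "degree (pderiv p) \<le> n"
    using Suc.prems by (simp add: degree_pderiv)
  note IH = Suc.IH[OF this]
  define w where "w = \<i> * lam"
  define g where "g k = of_real (poly ((pderiv ^^ k) p) (-1)) * exp (- w)
    - of_real (poly ((pderiv ^^ k) p) 1) * exp w" for k
  have w: "w \<noteq> 0" using assms(1) by (simp add: w_def)
  have "hat (pderiv p) lam = (\<Sum>k=0..n. (-1) ^ (k + 1) * (g (Suc k) / w ^ (k + 1)))"
    unfolding IH g_def w_def by (simp only: funpow_Suc_right o_apply)
  \<comment> \<open>Pulling out \<open>- w\<close> raises both exponents by one, so that the sum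
    becomes the tail \<open>k >= 1\<close> of the sum sought for \<open>p\<close>.\<close>
  also have "\<dots> = - w * (\<Sum>k=0..n. (-1) ^ (Suc k + 1) * (g (Suc k) / w ^ (Suc k + 1)))"
    unfolding sum_distrib_left using w by (intro sum.cong) simp_all
  finally have "hat p lam = (- g 0 + w * (\<Sum>k=0..n. (-1) ^ (Suc k + 1) * (g (Suc k) / w ^ (Suc k + 1)))) / w"
    by (simp add: hat_by_parts[OF assms(1), of p] g_def w_def[symmetric])
  also have "\<dots> = (-1) ^ (0 + 1) * (g 0 / w ^ (0 + 1))
      + (\<Sum>k=0..n. (-1) ^ (Suc k + 1) * (g (Suc k) / w ^ (Suc k + 1)))"
    using w by (simp add: add_divide_distrib diff_divide_distrib)
  also have "\<dots> = (\<Sum>k=0..Suc n. (-1) ^ (k + 1) * (g k / w ^ (k + 1)))"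
    by (simp only: sum.atLeast0_atMost_Suc_shift comp_def)
  finally show ?case unfolding g_def w_def .
qed

text \<open>Powers of \<open>x - 1\<close> have no boundary term at 1 once the exponent is positive.
  The boundary term at -1 supplies exactly the next summand of the truncated exponential, while the
  remaining integral reproduces the previous case. Factoring out \<open>exp (\<i> * lam)\<close>
  turns \<open>exp (- (\<i> * lam))\<close> into \<open>exp (- (2 * \<i> * lam))\<close>.\<close>

lemma hat_power_shift:
  assumes "lam \<noteq> 0"
  shows "hat ([:-1, 1:] ^ k) lam = exp (\<i> * lam) * (2 ^ (k + 1) * fact k *
    ((exp (- (2 * \<i> * lam)) * exp_trunc k (2 * \<i> * lam) - 1) / (- (2 * \<i> * lam)) ^ (k + 1)))"
proof (induction k)
  case 0
  have "exp (\<i> * lam) * exp (- (2 * \<i> * lam)) = exp (- (\<i> * lam))"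
    by (simp add: exp_add[symmetric])
  with hat_by_parts[OF assms, of 1] assms show ?case
    by (simp add: hat_0 exp_trunc_def right_diff_distrib diff_divide_distrib)
next
  case (Suc k)
  define w where "w = 2 * \<i> * lam"
  have w: "w \<noteq> 0" "\<i> * lam = w / 2" using assms by (simp_all add: w_def)
  have e: "exp (- (w / 2)) = exp (w / 2) * exp (- w)"
    by (simp add: exp_add[symmetric])
  have d: "pderiv ([:-1, 1:] ^ Suc k) = smult (of_nat (Suc k)) ([:-1, 1 :: real:] ^ k)"
    by (simp only: pderiv_power_Suc) (simp add: pderiv_pCons)
  have IH: "hat ([:-1, 1:] ^ k) lam = exp (w / 2) * (2 ^ (k + 1) * fact k *
    ((exp (- w) * exp_trunc k w - 1) / (- w) ^ (k + 1)))"
    using Suc.IH unfolding w_def[symmetric] w(2) .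
  have E: "exp_trunc (Suc k) w = exp_trunc k w + w ^ (k + 1) / (of_nat (Suc k) * fact k)"
    by (simp add: exp_trunc_def)
  \<comment> \<open>All powers of negative quantities share this one sign; since it is 1 or -1, the
    remaining algebra splits into two rational identities.\<close>
  define s :: complex where "s = (-1) ^ (k + 1)"
  have s: "s = 1 \<or> s = -1"
    unfolding s_def by (simp add: minus_one_power_iff)
  have sw: "(- w) ^ (k + 1) = s * w ^ (k + 1)" and s2: "(- 2) ^ (k + 1) = s * 2 ^ (k + 1)"
    unfolding s_def by (rule power_minus)+
  have sw': "(- w) ^ (Suc k + 1) = - (s * w ^ (k + 1) * w)"
    using sw by simp
  \<comment> \<open>The induction step as a rational identity, with \<open>D\<close> for
    \<open>2 ^ (k + 1)\<close>, \<open>e\<close> for \<open>exp (w / 2)\<close>, \<open>F\<close>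
    for \<open>exp (- w)\<close>, \<open>c\<close> for \<open>k + 1\<close>, \<open>f\<close> for
    \<open>fact k\<close>, \<open>X\<close> for \<open>exp_trunc k w\<close> and \<open>W\<close>
    for \<open>w ^ (k + 1)\<close>.\<close>
  have alg: "(- (s * D * (e * F)) - c * (e * (D * f * ((F * X - 1) / (s * W))))) / (w / 2)
      = e * ((2 * D) * (c * f) * ((F * (X + W / (c * f)) - 1) / (- (s * W * w))))"
    if "c \<noteq> 0" "f \<noteq> 0" "W \<noteq> 0" for D e F c f X W :: complex
    using s
  proof
    assume "s = 1"
    with that w(1) show ?thesis by (simp add: divide_simps) (simp add: algebra_simps)
  next
    assume "s = -1"
    with that w(1) show ?thesis by (simp add: divide_simps) (simp add: algebra_simps)
  qed
  have "poly ([:-1, 1:] ^ Suc k) 1 = (0 :: real)" "poly ([:-1, 1:] ^ Suc k) (-1) = (- 2 :: real) ^ (k + 1)"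
    by (simp_all only: poly_power) simp_all
  then have "hat ([:-1, 1:] ^ Suc k) lam = (- (s * 2 ^ (k + 1) * (exp (w / 2) * exp (- w)))
    - of_nat (Suc k) * (exp (w / 2) * (2 ^ (k + 1) * fact k *
        ((exp (- w) * exp_trunc k w - 1) / (s * w ^ (k + 1)))))) / (w / 2)"
    unfolding hat_by_parts[OF assms, of "[:-1, 1:] ^ Suc k"] d hat_smult IH w(2) e sw s2[symmetric]
    by (simp only: of_real_0 of_real_power of_real_minus of_real_numeral of_real_of_nat_eq mult_zero_left diff_0)
  also have "\<dots> = exp (w / 2) * ((2 * 2 ^ (k + 1)) * (of_nat (Suc k) * fact k) *
      ((exp (- w) * exp_trunc (Suc k) w - 1) / (- w) ^ (Suc k + 1)))"
    unfolding E sw' by (rule alg) (use w(1) in \<open>simp_all del: of_nat_Suc\<close>)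
  also have "(2 :: complex) * 2 ^ (k + 1) = 2 ^ (Suc k + 1)"
    by simp
  also have "of_nat (Suc k) * fact k = (fact (Suc k) :: complex)"
    by simp
  finally show ?case
    unfolding w_def[symmetric] w(2) .
qed

section \<open>Expansion of the second-kind polynomials in powers of \<open>x - 1\<close>\<close>

text \<open>By Pascal's rule applied twice, the second difference in \<open>n\<close> of the
  coefficient of \<open>y ^ k\<close> is \<open>(n + k + 1) choose (2 * k - 1)\<close> for
  \<open>k >= 1\<close>, which is the coefficient of \<open>y ^ (k - 1)\<close> in
  \<open>S (Suc n)\<close>.\<close>

lemma sum_binomial_odd_recurrence:
  fixes y :: "'a :: comm_ring_1"
  defines "S \<equiv> \<lambda>n. \<Sum>k\<le>n. of_nat ((n + k + 1) choose (2 * k + 1)) * y ^ k"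
  shows "S (Suc (Suc n)) = (y + 2) * S (Suc n) - S n"
proof -
  let ?c = "\<lambda>m k. of_nat (m choose k) :: 'a"
  \<comment> \<open>The three sums are brought to a common range; the added binomials vanish because
    \<open>2 * k + 1\<close> exceeds \<open>m + k + 1\<close> for \<open>k > m\<close>.\<close>
  have S: "S m = (\<Sum>k\<le>Suc (Suc n). ?c (m + k + 1) (2 * k + 1) * y ^ k)" if "m \<le> Suc (Suc n)" for m
    unfolding S_def using that by (intro sum.mono_neutral_left) (auto simp: binomial_eq_0)
  have "S (Suc (Suc n)) - 2 * S (Suc n) + S n = (\<Sum>k\<le>Suc (Suc n). 
     (?c (n + k + 3) (2 * k + 1) - 2 * ?c (n + k + 2) (2 * k + 1) + ?c (n + k + 1) (2 * k + 1)) * y ^ k)"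
    by (simp only: S le_refl le_SucI sum_distrib_left sum.distrib[symmetric] sum_subtractf[symmetric])
      (intro sum.cong, simp_all add: algebra_simps numeral_eq_Suc)
  \<comment> \<open>The term \<open>k = 0\<close> drops out, its coefficient being the second
    difference of a linear function of \<open>n\<close>; shifting the index releases the factor
    \<open>y\<close>.\<close>
  also have "\<dots> = y * S (Suc n)"
    by (subst sum.atMost_Suc_shift)
      (simp add: S_def sum_distrib_left numeral_eq_Suc algebra_simps)
  finally show ?thesis by (simp add: algebra_simps)
qed

text \<open>At \<open>y = 2 * (cos \<theta> - 1)\<close> the factor \<open>y + 2\<close> equals
  \<open>2 * cos \<theta>\<close>, so the binomial sum, multiplied by \<open>sin \<theta>\<close>,
  obeys the same recurrence as \<open>sin (real (n + 1) * \<theta>)\<close>, with the same first two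
  values.\<close>

lemma cheb_U_expansion:
  "cheb_U n = (\<Sum>k\<le>n. smult (2 ^ k * of_nat ((n + k + 1) choose (2 * k + 1))) ([:-1, 1:] ^ k))"
proof (rule poly_eqI_cos)
  fix \<theta> :: real assume nz: "sin \<theta> \<noteq> 0"
  define S where "S n = (\<Sum>k\<le>n. of_nat ((n + k + 1) choose (2 * k + 1)) * (2 * (cos \<theta> - 1)) ^ k)" for n
  have "S n * sin \<theta> = sin (real (n + 1) * \<theta>)"
  proof (induction n rule: induct_nat_012)
    case 0
    show ?case by (simp add: S_def)
  next
    case 1
    show ?case by (simp add: S_def algebra_simps sin_double[of \<theta>, simplified mult.commute[of 2]])
  next
    case (ge2 n)
    have "S (Suc (Suc n)) = 2 * cos \<theta> * S (Suc n) - S n"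
      unfolding S_def sum_binomial_odd_recurrence by simp
    then have "S (Suc (Suc n)) * sin \<theta> = 2 * cos \<theta> * (S (Suc n) * sin \<theta>) - S n * sin \<theta>"
      by (simp only: left_diff_distrib mult.assoc)
    also have "\<dots> = sin (real (Suc (Suc n) + 1) * \<theta>)"
    \<comment> \<open>The recurrence for the sines is \<open>sin (a + \<theta>) + sin (a - \<theta>)
      = 2 * cos \<theta> * sin a\<close>.\<close>
    proof -
      let ?a = "real (Suc n + 1) * \<theta>"
      have "real (Suc (Suc n) + 1) * \<theta> = ?a + \<theta>" "real (n + 1) * \<theta> = ?a - \<theta>"
        by (simp_all add: algebra_simps)
      then show ?thesis unfolding ge2 by (simp add: sin_add sin_diff del: of_nat_Suc of_nat_add)
    qed
    finally show ?case .
  qed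
  with nz have "sin (real (n + 1) * \<theta>) / sin \<theta> = S n"
    by (simp add: field_simps)
  then show "poly (cheb_U n) (cos \<theta>) = poly (\<Sum>k\<le>n. smult (2 ^ k * of_nat ((n + k + 1) choose (2 * k + 1)))
      ([:-1, 1:] ^ k)) (cos \<theta>)"
    unfolding cheb_U_cos[OF nz] S_def poly_sum poly_smult poly_power power_mult_distrib
    by (simp add: mult_ac)
qed

section \<open>Derivatives at the endpoints, and parity\<close>

text \<open>This isolates a single term of an expansion about 1: the derivative of order
  \<open>k\<close> there is \<open>fact k\<close> times the coefficient of the power
  \<open>k\<close>.\<close>

lemma higher_pderiv_power_shift_at_1:
  "poly ((pderiv ^^ j) ([:-1, 1 :: real:] ^ k)) 1 = (if j = k then fact k else 0)"
proof (induction j arbitrary: k)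
  case 0
  show ?case by (simp add: poly_power)
next
  case (Suc j)
  show ?case
  proof (cases k)
    case 0
    then show ?thesis by (simp add: funpow_Suc_right del: funpow.simps)
  next
    case (Suc m)
    have "pderiv ([:-1, 1:] ^ Suc m) = smult (of_nat (Suc m)) ([:-1, 1 :: real:] ^ m)"
      by (simp only: pderiv_power_Suc) (simp add: pderiv_pCons)
    with Suc Suc.IH[of m] show ?thesis
      by (simp add: funpow_Suc_right higher_pderiv_smult del: funpow.simps power_Suc)
  qed
qed

lemma higher_pderiv_cheb_U_at_1:
  assumes "k \<le> n"
  shows "poly ((pderiv ^^ k) (cheb_U n)) 1
    = 2 ^ k * fact k * fact (n + k + 1) / (fact (2 * k + 1) * fact (n - k))"
proof -
  have "(n + k + 1) - (2 * k + 1) = n - k" by simp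
  then have "real ((n + k + 1) choose (2 * k + 1)) = fact (n + k + 1) / (fact (2 * k + 1) * fact (n - k))"
    using assms by (subst binomial_fact) simp_all
  moreover have "poly ((pderiv ^^ k) (cheb_U n)) 1
      = (\<Sum>j\<le>n. if k = j then 2 ^ k * of_nat ((n + k + 1) choose (2 * k + 1)) * fact k else 0)"
    unfolding cheb_U_expansion higher_pderiv_sum higher_pderiv_smult poly_sum poly_smult
      higher_pderiv_power_shift_at_1
    by (intro sum.cong) auto
  ultimately show ?thesis
    using assms by simp
qed

text \<open>By the chain rule every differentiation of \<open>p(-x)\<close> contributes one factor
  -1.\<close>

lemma higher_pderiv_minus_arg:
  fixes p :: "real poly"
  assumes "pcompose p [:0, -1:] = smult c p"
  shows "pcompose ((pderiv ^^ k) p) [:0, -1:] = smult ((-1) ^ k * c) ((pderiv ^^ k) p)"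
proof (induction k)
  case 0
  then show ?case using assms by simp
next
  case (Suc k)
  have "pderiv (pcompose ((pderiv ^^ k) p) [:0, -1:]) = - pcompose ((pderiv ^^ Suc k) p) [:0, -1:]"
    by (simp add: pderiv_pcompose pderiv_pCons)
  then have "pcompose ((pderiv ^^ Suc k) p) [:0, -1:] = - smult ((-1) ^ k * c) ((pderiv ^^ Suc k) p)"
    unfolding Suc by (simp add: pderiv_smult)
  then show ?case by simp
qed

lemma higher_pderiv_at_minus_1:
  fixes p :: "real poly"
  assumes "pcompose p [:0, -1:] = smult ((-1) ^ n) p" and "k \<le> n"
  shows "poly ((pderiv ^^ k) p) (-1) = (-1) ^ (n - k) * poly ((pderiv ^^ k) p) 1"
proof -
  have "poly (pcompose ((pderiv ^^ k) p) [:0, -1:]) 1 = (-1) ^ k * (-1) ^ n * poly ((pderiv ^^ k) p) 1"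
    by (simp add: higher_pderiv_minus_arg[OF assms(1)])
  \<comment> \<open>Here \<open>k \<le> n\<close> matters: only then does the truncated difference
    \<open>n - k\<close> have the parity of \<open>n + k\<close>.\<close>
  moreover have "(-1 :: real) ^ k * (-1) ^ n = (-1) ^ (n - k)"
    using assms(2) by (simp add: minus_one_power_iff)
  ultimately show ?thesis by (simp add: poly_pcompose)
qed

text \<open>Shifting the angle by \<open>pi\<close> negates the cosine and multiplies
  \<open>cos (real n * \<theta>)\<close> by \<open>(-1) ^ n\<close>.\<close>

lemma cheb_T_minus_arg: "pcompose (cheb_T n) [:0, -1:] = smult ((-1) ^ n) (cheb_T n)"
proof (rule poly_eqI_cos)
  fix \<theta> :: real
  have "poly (cheb_T n) (- cos \<theta>) = cos (real n * (\<theta> + pi))"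
    using cheb_T_cos[of n "\<theta> + pi"] by simp
  also have "\<dots> = (-1) ^ n * cos (real n * \<theta>)"
    by (simp add: distrib_left cos_add mult.commute[of _ pi])
  finally show "poly (pcompose (cheb_T n) [:0, -1:]) (cos \<theta>) = poly (smult ((-1) ^ n) (cheb_T n)) (cos \<theta>)"
    by (simp add: poly_pcompose cheb_T_cos)
qed

text \<open>Both sides of \<open>poly (cheb_T (Suc n)) (cos t) = cos (real (Suc n) * t)\<close> are
  differentiated in \<open>t\<close>, and \<open>sin \<theta>\<close> is then cancelled.\<close>

lemma pderiv_cheb_T: "pderiv (cheb_T (Suc n)) = smult (of_nat (Suc n)) (cheb_U n)"
proof (rule poly_eqI_cos)
  fix \<theta> :: real assume nz: "sin \<theta> \<noteq> 0"
  have "((\<lambda>t. poly (cheb_T (Suc n)) (cos t)) has_real_derivative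
      poly (pderiv (cheb_T (Suc n))) (cos \<theta>) * (- sin \<theta>)) (at \<theta>)"
    by (rule DERIV_chain2[OF poly_DERIV DERIV_cos])
  moreover have "((\<lambda>t. cos (real (Suc n) * t)) has_real_derivative
      - sin (real (Suc n) * \<theta>) * real (Suc n)) (at \<theta>)"
    by (auto intro!: derivative_eq_intros simp del: of_nat_Suc)
  ultimately have "poly (pderiv (cheb_T (Suc n))) (cos \<theta>) * (- sin \<theta>) = - sin (real (Suc n) * \<theta>) * real (Suc n)"
    unfolding cheb_T_cos by (rule DERIV_unique)
  with nz show "poly (pderiv (cheb_T (Suc n))) (cos \<theta>) = poly (smult (of_nat (Suc n)) (cheb_U n)) (cos \<theta>)"
    by (simp add: cheb_U_cos field_simps)
qed

text \<open>The parity is inherited from \<open>cheb_T (Suc n)\<close>: differentiating once lowers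
  the exponent of the sign from \<open>n + 1\<close> to \<open>n\<close>, modulo 2.\<close>

lemma cheb_U_minus_arg: "pcompose (cheb_U n) [:0, -1:] = smult ((-1) ^ n) (cheb_U n)"
proof -
  have "smult (real (Suc n)) (pcompose (cheb_U n) [:0, -1:]) = smult (real (Suc n)) (smult ((-1) ^ n) (cheb_U n))"
    using higher_pderiv_minus_arg[OF cheb_T_minus_arg, of 1 "Suc n"]
    by (simp add: pderiv_cheb_T pcompose_smult mult.commute del: of_nat_Suc)
  then show ?thesis
    by (metis of_nat_eq_0_iff nat.distinct(1) smult_cancel)
qed

lemma degree_cheb_U_le: "degree (cheb_U n) \<le> n"
  unfolding cheb_U_expansion
proof (rule degree_sum_le)
  fix k assume "k \<in> {..n}"
  then show "degree (smult (2 ^ k * of_nat ((n + k + 1) choose (2 * k + 1))) ([:-1, 1:] ^ k) :: real poly) \<le> n"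
    by (intro order.trans[OF degree_smult_le] order.trans[OF degree_power_le]) simp
qed simp

lemma degree_cheb_T_le: "degree (cheb_T n) \<le> n"
proof (cases n)
  case 0
  have "cheb_T 0 = 1"
    by (rule poly_eqI_cos) (simp add: cheb_T_cos)
  with 0 show ?thesis by simp
next
  case (Suc m)
  have "degree (pderiv (cheb_T n)) \<le> m"
    unfolding Suc pderiv_cheb_T using degree_cheb_U_le[of m] by (simp del: of_nat_Suc)
  with Suc show ?thesis by (simp add: degree_pderiv)
qed

lemma higher_pderiv_cheb_T_at_1:
  assumes "n \<ge> 1" and "k \<le> n"
  shows "poly ((pderiv ^^ k) (cheb_T n)) 1
    = of_nat n * 2 ^ k * fact (n + k) * fact k / (fact (n - k) * fact (2 * k) * of_nat (n + k))"
proof (cases k)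
  case 0
  \<comment> \<open>The value at 1 comes from the angle 0. The formula also gives 1 there, since
    \<open>n \<ge> 1\<close> lets the factor \<open>n\<close> cancel.\<close>
  with assms cheb_T_cos[of n 0] show ?thesis by simp
next
  case (Suc j)
  obtain m where m: "n = Suc m" using assms(1) by (cases n) auto
  from assms(2) Suc m have "j \<le> m" by simp
  \<comment> \<open>With \<open>n = m + 1\<close> and \<open>k = j + 1\<close>, splitting off the
    leading factor of each factorial leaves those of the formula for \<open>cheb_U m\<close> at
    order \<open>j\<close>. The factor \<open>n + k\<close> cancels the denominator, and the 2 from
    \<open>fact (2 * k)\<close> turns \<open>2 ^ k\<close> into \<open>2 ^ j\<close>.\<close>
  have f1: "fact (n + k) = real (n + k) * fact (m + j + 1)"
    by (simp add: m Suc)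
  have f2: "fact (2 * k) = 2 * real k * fact (2 * j + 1)"
    by (simp add: Suc)
  have f3: "fact k = real k * fact j" by (simp add: Suc)
  have "real k \<noteq> 0" "real (n + k) \<noteq> 0" by (simp_all add: Suc)
  have "poly ((pderiv ^^ k) (cheb_T n)) 1 = real n * poly ((pderiv ^^ j) (cheb_U m)) 1"
    by (simp add: m Suc funpow_Suc_right pderiv_cheb_T higher_pderiv_smult del: funpow.simps of_nat_Suc)
  also have "\<dots> = real n * (2 ^ j * fact j * fact (m + j + 1) / (fact (2 * j + 1) * fact (m - j)))"
    by (simp only: higher_pderiv_cheb_U_at_1[OF \<open>j \<le> m\<close>])
  also have "\<dots> = of_nat n * 2 ^ k * fact (n + k) * fact k / (fact (n - k) * fact (2 * k) * of_nat (n + k))"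
    unfolding f1 f2 f3 using \<open>real k \<noteq> 0\<close> \<open>real (n + k) \<noteq> 0\<close>
    by (simp add: m Suc field_simps del: fact_Suc of_nat_Suc of_nat_add)
  finally show ?thesis .
qed

theorem theorem4p1:
  fixes lam :: complex
  assumes "lam \<noteq> 0"
  shows "(\<forall>n::nat.
      hat (cheb_U n) lam =
        exp (\<i> * lam) * (\<Sum>k=0..n. 2 ^ (2 * k + 1) * fact k * of_nat ((n + k + 1) choose (n - k)) *
          ((exp (- (2 * \<i> * lam)) * exp_trunc k (2 * \<i> * lam) - 1) / (- (2 * \<i> * lam)) ^ (k + 1))) \<and>
      hat (cheb_U n) lam =
        (\<Sum>k=0..n. (2 ^ (2 * k + 1) * fact (n + k + 1) * fact k) / (fact (2 * k + 1) * fact (n - k)) *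
          (((-1) ^ (n - k) * exp (- (\<i> * lam)) - exp (\<i> * lam)) / (- (2 * \<i> * lam)) ^ (k + 1)))) \<and>
    (\<forall>n::nat. n \<ge> 1 \<longrightarrow>
      hat (cheb_T n) lam =
        (\<Sum>k=0..n. (-1) ^ (k + 1) *
          ((of_nat n * 2 ^ k * fact (n + k) * fact k) / (fact (n - k) * fact (2 * k) * of_nat (n + k))) *
          (((-1) ^ (n - k) * exp (- (\<i> * lam)) - exp (\<i> * lam)) / (\<i> * lam) ^ (k + 1))))"
proof (intro conjI allI impI)
  fix n :: nat
  let ?w = "2 * \<i> * lam"
  let ?G = "\<lambda>k. (exp (- ?w) * exp_trunc k ?w - 1) / (- ?w) ^ (k + 1)"
  \<comment> \<open>First form: the expansion about 1 is transformed term by term.\<close>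
  have "hat (cheb_U n) lam = (\<Sum>k=0..n. 2 ^ k * of_nat ((n + k + 1) choose (2 * k + 1)) *
      (exp (\<i> * lam) * (2 ^ (k + 1) * fact k * ?G k)))"
    by (simp only: cheb_U_expansion hat_sum hat_smult hat_power_shift[OF assms] atMost_atLeast0
        of_real_mult of_real_power of_real_of_nat_eq of_real_numeral)
  also have "\<dots> = exp (\<i> * lam) * (\<Sum>k=0..n. 2 ^ (2 * k + 1) * fact k *
      of_nat ((n + k + 1) choose (n - k)) * ?G k)"
    unfolding sum_distrib_left
  proof (rule sum.cong[OF refl])
    fix k assume k: "k \<in> {0..n}"
    have "(n + k + 1) choose (2 * k + 1) = (n + k + 1) choose (n - k)"
      using k binomial_symmetric[of "2 * k + 1" "n + k + 1"] by simp
    moreover have "2 ^ (2 * k + 1) = (2 :: complex) ^ k * 2 ^ (k + 1)"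
      unfolding power_add[symmetric] by (rule arg_cong[of _ _ "power 2"]) simp
    ultimately show "2 ^ k * of_nat ((n + k + 1) choose (2 * k + 1)) *
        (exp (\<i> * lam) * (2 ^ (k + 1) * fact k * ?G k)) = exp (\<i> * lam) *
        (2 ^ (2 * k + 1) * fact k * of_nat ((n + k + 1) choose (n - k)) * ?G k)"
      by (simp only: mult_ac)
  qed
  finally show "hat (cheb_U n) lam = exp (\<i> * lam) * (\<Sum>k=0..n. 2 ^ (2 * k + 1) * fact k *
      of_nat ((n + k + 1) choose (n - k)) * ?G k)" .
next
  fix n :: nat
  show "hat (cheb_U n) lam =
        (\<Sum>k=0..n. (2 ^ (2 * k + 1) * fact (n + k + 1) * fact k) / (fact (2 * k + 1) * fact (n - k)) *
          (((-1) ^ (n - k) * exp (- (\<i> * lam)) - exp (\<i> * lam)) / (- (2 * \<i> * lam)) ^ (k + 1)))"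
    \<comment> \<open>Second form: parity turns each boundary term into the derivative at 1 times a
      combination of exponentials.\<close>
    unfolding hat_eq_sum_higher_pderiv[OF assms degree_cheb_U_le]
  proof (rule sum.cong[OF refl])
    fix k assume "k \<in> {0..n}"
    then have k: "k \<le> n" by simp
    define Q :: complex where
      "Q = 2 ^ k * fact k * fact (n + k + 1) / (fact (2 * k + 1) * fact (n - k))"
    define Y where "Y = (-1) ^ (n - k) * exp (- (\<i> * lam)) - exp (\<i> * lam)"
    have Q: "of_real (poly ((pderiv ^^ k) (cheb_U n)) 1) = Q"
      by (simp add: higher_pderiv_cheb_U_at_1[OF k] Q_def del: fact_Suc)
    have "of_real (poly ((pderiv ^^ k) (cheb_U n)) (-1)) * exp (- (\<i> * lam))
        - of_real (poly ((pderiv ^^ k) (cheb_U n)) 1) * exp (\<i> * lam) = Q * Y"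
      by (simp add: higher_pderiv_at_minus_1[OF cheb_U_minus_arg k] Q Y_def right_diff_distrib mult.left_commute)
    moreover have "(2 ^ (2 * k + 1) * fact (n + k + 1) * fact k) / (fact (2 * k + 1) * fact (n - k))
        = 2 ^ (k + 1) * Q"
    proof -
      have "2 ^ (2 * k + 1) = (2 :: complex) ^ (k + 1) * 2 ^ k"
        unfolding power_add[symmetric] by (rule arg_cong[of _ _ "power 2"]) simp
      then show ?thesis
        unfolding Q_def by (simp only: times_divide_eq_right mult_ac)
    qed
    moreover define s :: complex where "s = (-1) ^ (k + 1)"
    moreover have "(- (2 * \<i> * lam)) ^ (k + 1) = s * 2 ^ (k + 1) * (\<i> * lam) ^ (k + 1)"
      unfolding s_def power_mult_distrib[symmetric] by (simp only: mult_1_left mult_minus_left mult.assoc)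
    \<comment> \<open>The denominator \<open>(- (2 * \<i> * lam)) ^ (k + 1)\<close> absorbs both the
      sign, which is its own inverse, and the extra factor \<open>2 ^ (k + 1)\<close>.\<close>
    moreover have "s * (Q * Y / (\<i> * lam) ^ (k + 1))
        = 2 ^ (k + 1) * Q * (Y / (s * 2 ^ (k + 1) * (\<i> * lam) ^ (k + 1)))"
    proof -
      have "s = 1 \<or> s = -1"
        unfolding s_def by (simp add: minus_one_power_iff)
      then show ?thesis by (elim disjE) simp_all
    qed
    ultimately show "(-1) ^ (k + 1) *
      ((of_real (poly ((pderiv ^^ k) (cheb_U n)) (-1)) * exp (- (\<i> * lam))
        - of_real (poly ((pderiv ^^ k) (cheb_U n)) 1) * exp (\<i> * lam)) / (\<i> * lam) ^ (k + 1))
      = (2 ^ (2 * k + 1) * fact (n + k + 1) * fact k) / (fact (2 * k + 1) * fact (n - k)) *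
          (((-1) ^ (n - k) * exp (- (\<i> * lam)) - exp (\<i> * lam)) / (- (2 * \<i> * lam)) ^ (k + 1))"
      unfolding Y_def[symmetric] by (simp only:)
  qed
next
  fix n :: nat assume n: "n \<ge> 1"
  show "hat (cheb_T n) lam =
        (\<Sum>k=0..n. (-1) ^ (k + 1) *
          ((of_nat n * 2 ^ k * fact (n + k) * fact k) / (fact (n - k) * fact (2 * k) * of_nat (n + k))) *
          (((-1) ^ (n - k) * exp (- (\<i> * lam)) - exp (\<i> * lam)) / (\<i> * lam) ^ (k + 1)))"
    unfolding hat_eq_sum_higher_pderiv[OF assms degree_cheb_T_le]
  proof (rule sum.cong[OF refl])
    fix k assume "k \<in> {0..n}"
    then have k: "k \<le> n" by simp
    define Q :: complex where
      "Q = of_nat n * 2 ^ k * fact (n + k) * fact k / (fact (n - k) * fact (2 * k) * of_nat (n + k))"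
    have Q: "of_real (poly ((pderiv ^^ k) (cheb_T n)) 1) = Q"
      by (simp add: higher_pderiv_cheb_T_at_1[OF n k] Q_def)
    have "of_real (poly ((pderiv ^^ k) (cheb_T n)) (-1)) * exp (- (\<i> * lam))
        - of_real (poly ((pderiv ^^ k) (cheb_T n)) 1) * exp (\<i> * lam)
      = Q * ((-1) ^ (n - k) * exp (- (\<i> * lam)) - exp (\<i> * lam))"
      by (simp add: higher_pderiv_at_minus_1[OF cheb_T_minus_arg k] Q right_diff_distrib mult.left_commute)
    then show "(-1) ^ (k + 1) *
      ((of_real (poly ((pderiv ^^ k) (cheb_T n)) (-1)) * exp (- (\<i> * lam))
        - of_real (poly ((pderiv ^^ k) (cheb_T n)) 1) * exp (\<i> * lam)) / (\<i> * lam) ^ (k + 1))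
      = (-1) ^ (k + 1) *
          ((of_nat n * 2 ^ k * fact (n + k) * fact k) / (fact (n - k) * fact (2 * k) * of_nat (n + k))) *
          (((-1) ^ (n - k) * exp (- (\<i> * lam)) - exp (\<i> * lam)) / (\<i> * lam) ^ (k + 1))"
      unfolding Q_def[symmetric] by simp
  qed
qed

end
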